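(* Let $(X,\leq)$ be a partially ordered set endowed with a metric $d$ such that $(X,d)$ is complete, let $\varepsilon>0$ and $\lambda\in(0,1)$, and let $F:X\times X\to X$ be a mapping. Assume that: 1. $X$ is $\varepsilon$-chainable with respect to the partial order $\leq$; 2. $F$ is continuous; 3. $F$ has the mixed monotone property; 4. $F$ is $(\varepsilon,\lambda)$ uniformly locally contractive; 5. there exist $x_0,y_0\in X$ such that $x_0\leq F(x_0,y_0)$ and $y_0\geq F(y_0,x_0)$. Then $F$ admits a coupled fixed point, i.e. there exists $(x,y)\in X\times X$ with $F(x,y)=x$ and $F(y,x)=y$.
   Context: Let $(X,\leq)$ be a partially ordered set endowed with a metric $d$ and let $F:X\times X\to X$. $X\times X$ carries the metric $\eta((x,y),(u,v))=d(x,u)+d(y,v)$; continuity of $F$ is with respect to $\eta$ and $d$. $X$ is $\varepsilon$-chainable with respect to $\leq$ ($\varepsilon>0$) if for any $a,b\in X$ with $a\leq b$ there exist an integer $n\geq 1$ and points $a=\alpha_0\leq\alpha_1\leq\cdots\leq\alpha_{n-1}\leq\alpha_n=b$ of $X$ such that $d(\alpha_{i-1},\alpha_i)<\varepsilon$ for all $i=1,\dots,n$. $F$ has the mixed monotone property if for all $x,y\in X$: $x_1\leq x_2$ in $X$ implies $F(x_1,y)\leq F(x_2,y)$, and $y_1\leq y_2$ in $X$ implies $F(x,y_1)\geq F(x,y_2)$. $F$ is $(\varepsilon,\lambda)$ uniformly locally contractive ($\varepsilon>0$, $\lambda\in(0,1)$) if for all $x,y,u,v\in X$ with $x\geq u$,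 $y\leq v$ and $(x,y)\neq(u,v)$: $\frac{d(x,u)+d(y,v)}{2}<\varepsilon$ implies $d(F(x,y),F(u,v))<\frac{\lambda}{2}[d(x,u)+d(y,v)]$. *)

theory Defs
  imports "HOL-Analysis.Analysis"
begin

text \<open>The ambient space is a type of classes \<open>order\<close> and \<open>metric_space\<close>, with no compatibility
  assumed between the two structures.\<close>

text \<open>The sum metric on the product. The library's own \<open>dist\<close> on pairs is the Euclidean
  combination, so the sum metric is introduced separately.\<close>

definition eta :: "'a::metric_space \<times> 'a \<Rightarrow> 'a \<times> 'a \<Rightarrow> real" where
  "eta p q = dist (fst p) (fst q) + dist (snd p) (snd q)"

lemma Metric_space_eta: "Metric_space UNIV (eta :: 'a::metric_space \<times> 'a \<Rightarrow> _)"
proof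
  fix p q r :: "'a \<times> 'a"
  show "0 \<le> eta p q" by (simp add: eta_def)
  show "eta p q = eta q p" by (simp add: eta_def dist_commute)
  show "eta p q = 0 \<longleftrightarrow> p = q" by (simp add: eta_def add_nonneg_eq_0_iff prod_eq_iff)
  show "eta p r \<le> eta p q + eta q r"
    using dist_triangle[of "fst p" "fst r" "fst q"] dist_triangle[of "snd p" "snd r" "snd q"]
    by (simp add: eta_def)
qed

definition eta_continuous :: "('a::metric_space \<times> 'a \<Rightarrow> 'a) \<Rightarrow> bool" where
  "eta_continuous F \<longleftrightarrow> continuous_map (Metric_space.mtopology UNIV eta) euclidean F"

definition chainable :: "real \<Rightarrow> 'a::{order, metric_space} itself \<Rightarrow> bool" where
  "chainable \<epsilon> (_ :: 'a itself) \<longleftrightarrow>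
    (\<forall>a b :: 'a. a \<le> b \<longrightarrow>
      (\<exists>(n::nat) \<alpha>. n \<ge> 1 \<and> \<alpha> 0 = a \<and> \<alpha> n = b \<and>
        (\<forall>i\<in>{1..n}. \<alpha> (i - 1) \<le> \<alpha> i \<and> dist (\<alpha> (i - 1)) (\<alpha> i) < \<epsilon>)))"

definition mixed_monotone :: "('a::order \<times> 'a \<Rightarrow> 'a) \<Rightarrow> bool" where
  "mixed_monotone F \<longleftrightarrow>
    (\<forall>x y. (\<forall>x1 x2. x1 \<le> x2 \<longrightarrow> F (x1, y) \<le> F (x2, y)) \<and>
           (\<forall>y1 y2. y1 \<le> y2 \<longrightarrow> F (x, y1) \<ge> F (x, y2)))"

definition uniformly_locally_contractive ::
    "real \<Rightarrow> real \<Rightarrow> ('a::{order, metric_space} \<times> 'a \<Rightarrow> 'a) \<Rightarrow> bool" where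
  "uniformly_locally_contractive \<epsilon> l F \<longleftrightarrow>
    (\<forall>x y u v. x \<ge> u \<longrightarrow> y \<le> v \<longrightarrow> (x, y) \<noteq> (u, v) \<longrightarrow>
      (dist x u + dist y v) / 2 < \<epsilon> \<longrightarrow>
      dist (F (x, y)) (F (u, v)) < l / 2 * (dist x u + dist y v))"

definition coupled_fixed_point :: "('a \<times> 'a \<Rightarrow> 'a) \<Rightarrow> 'a \<times> 'a \<Rightarrow> bool" where
  "coupled_fixed_point F p \<longleftrightarrow> (case p of (x, y) \<Rightarrow> F (x, y) = x \<and> F (y, x) = y)"

end

theory Submission
  imports Defs
begin

text \<open>
  A coupled fixed point of \<open>F\<close> is the same thing as a fixed point of the map
  \<open>T (x, y) = (F (x, y), F (y, x))\<close> on \<open>X \<times> X\<close>. Give the product the order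
  \<open>(u, v) \<sqsubseteq> (x, y) \<longleftrightarrow> u \<le> x \<and> y \<le> v\<close>. Mixed monotonicity makes \<open>T\<close> monotone
  for this order, and local contractivity, applied to both components, makes \<open>T\<close> shrink the sum
  metric by the factor \<open>l\<close> on comparable points at distance less than \<open>2 * \<epsilon>\<close>. Monotonicity
  keeps comparable points comparable and the contraction keeps them close, so the estimate can be
  iterated: the orbits of two such points approach each other at the rate \<open>l ^ k\<close>
  (\<open>orbits_merge_near\<close>).

  Merging at this rate, with an unspecified constant, is a transitive relation. Therefore it passes
  along \<open>\<epsilon>\<close>-chains, and any two comparable points of \<open>X \<times> X\<close>, at whatever distance, have merging
  orbits (\<open>orbits_merge_comparable\<close>). The assumption on \<open>x0\<close> and \<open>y0\<close> is that the point
  \<open>p = (x0, y0)\<close> lies below \<open>T p\<close>. The orbits of \<open>p\<close> and \<open>T p\<close> are the same sequence shifted by one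
  step; that they merge at a geometric rate makes this sequence Cauchy. By completeness it
  converges, and continuity of \<open>F\<close> makes its limit a fixed point of \<open>T\<close>.
\<close>

definition coupled_map :: "('a \<times> 'a \<Rightarrow> 'a) \<Rightarrow> 'a \<times> 'a \<Rightarrow> 'a \<times> 'a" where
  "coupled_map F p = (F p, F (prod.swap p))"

text \<open>The second coordinate is reversed because \<open>F\<close> is antitone there.\<close>

definition mixed_le :: "'a::order \<times> 'a \<Rightarrow> 'a \<times> 'a \<Rightarrow> bool" where
  "mixed_le p q \<longleftrightarrow> fst p \<le> fst q \<and> snd q \<le> snd p"

text \<open>The constant \<open>C\<close> may depend on the two points; this freedom is what makes the relation
  transitive.\<close>

definition orbits_merge ::
    "real \<Rightarrow> ('a::metric_space \<times> 'a \<Rightarrow> 'a \<times> 'a) \<Rightarrow> 'a \<times> 'a \<Rightarrow> 'a \<times> 'a \<Rightarrow> bool" where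
  "orbits_merge l T p q \<longleftrightarrow> (\<exists>C. \<forall>k. eta ((T ^^ k) p) ((T ^^ k) q) \<le> C * l ^ k)"

lemma coupled_map_mono:
  assumes "mixed_monotone F" "mixed_le p q"
  shows "mixed_le (coupled_map F p) (coupled_map F q)"
proof -
  obtain u v x y where p: "p = (u, v)" and q: "q = (x, y)" by (cases p, cases q)
  have "u \<le> x" "y \<le> v" using assms(2) by (auto simp: mixed_le_def p q)
  then have "F (u, v) \<le> F (x, v)" "F (x, v) \<le> F (x, y)"
    and "F (y, x) \<le> F (v, x)" "F (v, x) \<le> F (v, u)"
    using assms(1) by (auto simp: mixed_monotone_def)
  then show ?thesis by (auto simp: mixed_le_def coupled_map_def p q)
qed

text \<open>The two components of \<open>coupled_map F\<close> compare \<open>F\<close> at \<open>(x, y)\<close> and \<open>(u, v)\<close>, and at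
  \<open>(v, u)\<close> and \<open>(y, x)\<close>. Both pairs are ordered as contractivity requires, and each contributes
  half of the factor \<open>l\<close>.\<close>

lemma coupled_map_contracts:
  assumes F: "uniformly_locally_contractive \<epsilon> l F"
    and le: "mixed_le p q" and near: "eta p q < 2 * \<epsilon>"
  shows "eta (coupled_map F p) (coupled_map F q) \<le> l * eta p q"
proof (cases "p = q")
  case True
  then show ?thesis by (simp add: eta_def)
next
  case False
  obtain u v x y where p: "p = (u, v)" and q: "q = (x, y)" by (cases p, cases q)
  have ord: "u \<le> x" "y \<le> v" and ne: "(x, y) \<noteq> (u, v)" "(v, u) \<noteq> (y, x)"
    using le False by (auto simp: mixed_le_def p q)
  have near': "(dist x u + dist y v) / 2 < \<epsilon>" "(dist v y + dist u x) / 2 < \<epsilon>"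
    using near by (simp_all add: eta_def p q dist_commute)
  have "dist (F (x, y)) (F (u, v)) < l / 2 * (dist x u + dist y v)"
    using F ord ne(1) near'(1) unfolding uniformly_locally_contractive_def by blast
  moreover have "dist (F (v, u)) (F (y, x)) < l / 2 * (dist v y + dist u x)"
    using F ord ne(2) near'(2) unfolding uniformly_locally_contractive_def by blast
  ultimately show ?thesis
    by (simp add: eta_def coupled_map_def p q dist_commute algebra_simps)
qed

lemma orbits_merge_refl: "orbits_merge l T p p"
  unfolding orbits_merge_def by (rule exI[of _ 0]) (simp add: eta_def)

lemma orbits_merge_trans:
  assumes "orbits_merge l T p q" "orbits_merge l T q r"
  shows "orbits_merge l T p r"
proof -
  obtain C D where C: "\<And>k. eta ((T ^^ k) p) ((T ^^ k) q) \<le> C * l ^ k"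
    and D: "\<And>k. eta ((T ^^ k) q) ((T ^^ k) r) \<le> D * l ^ k"
    using assms unfolding orbits_merge_def by blast
  have "eta ((T ^^ k) p) ((T ^^ k) r) \<le> (C + D) * l ^ k" for k
    using Metric_space.triangle[OF Metric_space_eta, of "(T ^^ k) p" "(T ^^ k) q" "(T ^^ k) r"]
      C[of k] D[of k] by (simp add: distrib_right)
  then show ?thesis unfolding orbits_merge_def by blast
qed

text \<open>The contraction estimate can be repeated because its hypotheses, comparability and the bound
  \<open>2 * \<epsilon>\<close>, survive each application of the map.\<close>

lemma orbits_merge_near:
  assumes l: "0 < l" "l < 1"
    and mono: "mixed_monotone F" and contr: "uniformly_locally_contractive \<epsilon> l F"
    and le: "mixed_le p q" and near: "eta p q < 2 * \<epsilon>"
  shows "orbits_merge l (coupled_map F) p q"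
proof -
  let ?T = "coupled_map F"
  have "mixed_le ((?T ^^ k) p) ((?T ^^ k) q) \<and> eta ((?T ^^ k) p) ((?T ^^ k) q) \<le> eta p q * l ^ k"
    for k
  proof (induction k)
    case 0
    show ?case using le by simp
  next
    case (Suc k)
    have "l ^ k \<le> 1" using l by (simp add: power_le_one)
    then have "eta p q * l ^ k \<le> eta p q"
      by (simp add: eta_def mult_left_le)
    then have "eta ((?T ^^ k) p) ((?T ^^ k) q) < 2 * \<epsilon>"
      using Suc.IH near by linarith
    then have "eta ((?T ^^ Suc k) p) ((?T ^^ Suc k) q) \<le> l * eta ((?T ^^ k) p) ((?T ^^ k) q)"
      using coupled_map_contracts[OF contr] Suc.IH by simp
    also have "\<dots> \<le> l * (eta p q * l ^ k)"
      using Suc.IH l by (intro mult_left_mono) auto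
    finally show ?case using coupled_map_mono[OF mono] Suc.IH by (simp add: mult_ac)
  qed
  then show ?thesis unfolding orbits_merge_def by blast
qed

text \<open>Chainability lets a reflexive and transitive relation be checked on short ordered steps
  only.\<close>

lemma chainable_induct:
  fixes a b :: "'a::{order, metric_space}"
  assumes "chainable \<epsilon> TYPE('a)" and "a \<le> b"
    and refl: "\<And>x. R x x" and trans: "\<And>x y z. R x y \<Longrightarrow> R y z \<Longrightarrow> R x z"
    and step: "\<And>x y. x \<le> y \<Longrightarrow> dist x y < \<epsilon> \<Longrightarrow> R x y"
  shows "R a b"
proof -
  obtain n :: nat and \<alpha> where \<alpha>: "\<alpha> 0 = a" "\<alpha> n = b"
    and steps: "\<And>i. i \<in> {1..n} \<Longrightarrow> \<alpha> (i - 1) \<le> \<alpha> i \<and> dist (\<alpha> (i - 1)) (\<alpha> i) < \<epsilon>"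
    using assms(1,2) unfolding chainable_def by blast
  have "R (\<alpha> 0) (\<alpha> i)" if "i \<le> n" for i
    using that
  proof (induction i)
    case 0
    show ?case by (rule refl)
  next
    case (Suc i)
    have "R (\<alpha> i) (\<alpha> (Suc i))" using steps[of "Suc i"] Suc.prems by (intro step) auto
    then show ?case using Suc trans by simp
  qed
  then show ?thesis using \<alpha> by blast
qed

text \<open>The segment from \<open>p\<close> to \<open>q\<close> is broken at \<open>(fst q, snd p)\<close>, so that each part changes one
  coordinate only and a chain in \<open>X\<close> suffices for it. In the second coordinate the mixed order is
  reversed, and the chain is traversed downwards.\<close>

lemma orbits_merge_comparable:
  fixes F :: "'a::{order, metric_space} \<times> 'a \<Rightarrow> 'a"
  assumes l: "0 < l" "l < 1" and chain: "chainable \<epsilon> TYPE('a)"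
    and mono: "mixed_monotone F" and contr: "uniformly_locally_contractive \<epsilon> l F"
    and le: "mixed_le p q"
  shows "orbits_merge l (coupled_map F) p q"
proof -
  let ?M = "orbits_merge l (coupled_map F)"
  note near = orbits_merge_near[OF l mono contr]
  have "?M (fst p, snd p) (fst q, snd p)"
  proof (rule chainable_induct[OF chain, where R = "\<lambda>x x'. ?M (x, snd p) (x', snd p)"])
    show "fst p \<le> fst q" using le by (simp add: mixed_le_def)
    show "?M (x, snd p) (x', snd p)" if "x \<le> x'" "dist x x' < \<epsilon>" for x x'
    proof (rule near)
      show "mixed_le (x, snd p) (x', snd p)" using that by (simp add: mixed_le_def)
      have "dist x x' < 2 * \<epsilon>" using that zero_le_dist[of x x'] by linarith
      then show "eta (x, snd p) (x', snd p) < 2 * \<epsilon>" by (simp add: eta_def)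
    qed
  qed (rule orbits_merge_refl, rule orbits_merge_trans)
  moreover have "?M (fst q, snd p) (fst q, snd q)"
  proof (rule chainable_induct[OF chain, where R = "\<lambda>y y'. ?M (fst q, y') (fst q, y)"])
    show "snd q \<le> snd p" using le by (simp add: mixed_le_def)
    show "?M (fst q, y') (fst q, y)" if "y \<le> y'" "dist y y' < \<epsilon>" for y y'
    proof (rule near)
      show "mixed_le (fst q, y') (fst q, y)" using that by (simp add: mixed_le_def)
      have "dist y y' < 2 * \<epsilon>" using that zero_le_dist[of y y'] by linarith
      then show "eta (fst q, y') (fst q, y) < 2 * \<epsilon>" by (simp add: eta_def dist_commute)
    qed
  qed (rule orbits_merge_refl, erule (1) orbits_merge_trans[rotated])
  ultimately have "?M (fst p, snd p) (fst q, snd q)" by (rule orbits_merge_trans)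
  then show ?thesis by simp
qed

lemma Cauchy_if_geometric_steps:
  fixes X :: "nat \<Rightarrow> 'a::metric_space"
  assumes l: "0 < l" "l < 1" and step: "\<And>k. dist (X k) (X (Suc k)) \<le> C * l ^ k"
  shows "Cauchy X"
proof -
  have C: "0 \<le> C"
    using order_trans[OF zero_le_dist step[of 0]] by simp
  define B where "B k = C / (1 - l) * l ^ k" for k
  have B_nonneg: "0 \<le> B k" for k using C l by (simp add: B_def)
  \<comment> \<open>\<open>B k\<close> is the sum of the bounds on the steps from \<open>k\<close> onwards.\<close>
  have B_Suc: "B k = C * l ^ k + B (Suc k)" for k
    using l by (simp add: B_def field_simps)
  have tail: "dist (X m) (X (m + j)) \<le> B m" for m j
  proof (induction j arbitrary: m)
    case 0
    show ?case using B_nonneg by simp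
  next
    case (Suc j)
    have "dist (X m) (X (m + Suc j)) \<le> dist (X m) (X (Suc m)) + dist (X (Suc m)) (X (Suc m + j))"
      using dist_triangle[of "X m" "X (Suc m + j)" "X (Suc m)"] by simp
    then show ?case using step[of m] Suc.IH[of "Suc m"] B_Suc[of m] by linarith
  qed
  have "B \<longlonglongrightarrow> C / (1 - l) * 0"
    unfolding B_def using l by (intro tendsto_mult tendsto_const LIMSEQ_realpow_zero) auto
  then have "B \<longlonglongrightarrow> 0" by simp
  show ?thesis
  proof (rule CauchyI')
    fix e :: real
    assume "0 < e"
    then obtain N where N: "\<And>k. N \<le> k \<Longrightarrow> B k < e"
      using order_tendstoD(2)[OF \<open>B \<longlonglongrightarrow> 0\<close>] unfolding eventually_sequentially by blast
    have "dist (X m) (X n) < e" if "N \<le> m" "m < n" for m n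
      using tail[of m "n - m"] N[of m] that by simp
    then show "\<exists>M. \<forall>m\<ge>M. \<forall>n>m. dist (X m) (X n) < e" by blast
  qed
qed

lemma eta_continuous_tendsto:
  assumes F: "eta_continuous F" and X: "X \<longlonglongrightarrow> x" and Y: "Y \<longlonglongrightarrow> y"
  shows "(\<lambda>n. F (X n, Y n)) \<longlonglongrightarrow> F (x, y)"
proof -
  have "(\<lambda>n. dist (X n) x + dist (Y n) y) \<longlonglongrightarrow> 0 + 0"
    using X[THEN tendsto_dist_iff[THEN iffD1]] Y[THEN tendsto_dist_iff[THEN iffD1]]
    by (rule tendsto_add)
  then have "(\<lambda>n. eta (X n, Y n) (x, y)) \<longlonglongrightarrow> 0"
    by (simp add: eta_def)
  then have "\<forall>\<^sub>F n in sequentially. (X n, Y n) \<in> UNIV \<and> eta (X n, Y n) (x, y) < e"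
    if "0 < e" for e
    using order_tendstoD(2)[OF _ that] by simp
  then have "limitin (Metric_space.mtopology UNIV eta) (\<lambda>n. (X n, Y n)) (x, y) sequentially"
    by (intro Metric_space.limitin_metric[OF Metric_space_eta, THEN iffD2] conjI UNIV_I allI impI)
  then have "limitin euclidean (F \<circ> (\<lambda>n. (X n, Y n))) (F (x, y)) sequentially"
    using F[unfolded eta_continuous_def] by (rule continuous_map_limit[rotated])
  then show ?thesis by (simp add: o_def)
qed

theorem theorem2p1:
  fixes F :: "'a::{order, complete_space} \<times> 'a \<Rightarrow> 'a"
    and \<epsilon> l :: real
  assumes "\<epsilon> > 0"
    and "0 < l" and "l < 1"
    and "chainable \<epsilon> TYPE('a)"
    and "eta_continuous F"
    and "mixed_monotone F"
    and "uniformly_locally_contractive \<epsilon> l F"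
    and "\<exists>x0 y0. x0 \<le> F (x0, y0) \<and> y0 \<ge> F (y0, x0)"
  shows "\<exists>p. coupled_fixed_point F p"
proof -
  let ?T = "coupled_map F"
  obtain x0 y0 where "x0 \<le> F (x0, y0)" "y0 \<ge> F (y0, x0)"
    using assms(8) by blast
  then have "mixed_le (x0, y0) (?T (x0, y0))"
    by (simp add: mixed_le_def coupled_map_def)
  then have "orbits_merge l ?T (x0, y0) (?T (x0, y0))"
    using orbits_merge_comparable assms by blast
  then obtain C where C: "\<And>k. eta ((?T ^^ k) (x0, y0)) ((?T ^^ k) (?T (x0, y0))) \<le> C * l ^ k"
    unfolding orbits_merge_def by blast
  define X where "X k = fst ((?T ^^ k) (x0, y0))" for k
  define Y where "Y k = snd ((?T ^^ k) (x0, y0))" for k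
  have rec: "X (Suc k) = F (X k, Y k)" "Y (Suc k) = F (Y k, X k)" for k
    by (simp_all add: X_def Y_def coupled_map_def prod.swap_def)
  have steps: "dist (X k) (X (Suc k)) + dist (Y k) (Y (Suc k)) \<le> C * l ^ k" for k
    using C[of k] by (simp add: X_def Y_def eta_def funpow_swap1)
  have X_step: "dist (X k) (X (Suc k)) \<le> C * l ^ k"
    and Y_step: "dist (Y k) (Y (Suc k)) \<le> C * l ^ k" for k
    using steps[of k] zero_le_dist[of "X k" "X (Suc k)"] zero_le_dist[of "Y k" "Y (Suc k)"]
    by linarith+
  obtain x y where x: "X \<longlonglongrightarrow> x" and y: "Y \<longlonglongrightarrow> y"
    using Cauchy_if_geometric_steps[OF assms(2,3) X_step]
      Cauchy_if_geometric_steps[OF assms(2,3) Y_step]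
    by (auto simp: Cauchy_convergent_iff convergent_def)
  have "(\<lambda>k. X (Suc k)) \<longlonglongrightarrow> F (x, y)" "(\<lambda>k. Y (Suc k)) \<longlonglongrightarrow> F (y, x)"
    using eta_continuous_tendsto[OF assms(5)] x y by (simp_all add: rec)
  then have "F (x, y) = x" "F (y, x) = y"
    using LIMSEQ_Suc[OF x] LIMSEQ_Suc[OF y] LIMSEQ_unique by blast+
  then show ?thesis
    by (auto simp: coupled_fixed_point_def)
qed

end
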